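(* Let $G$ be a finite simple graph on $n$ vertices with at least one edge, and let $\omega=\omega(G)$ be its clique number. Then there exists a probability distribution $\mathcal D_{\mathcal P}$ over partitions of $V(G)$ into at most $\omega$ parts such that, for every choice of nonnegative real edge weights $a=(a_e)_{e\in E(G)}$, $$\mathbb{E}_{\mathcal P\sim\mathcal D_{\mathcal P}}\,W_{\mathcal P}(a)\;\ge\;\frac{2}{\left(1-\frac1\omega\right)n^2}\Bigl(\sum_{e\in E(G)}\sqrt{a_e}\Bigr)^{2}.$$ (The distribution depends only on $G$, not on the weights $a$.)
   Context: Graphs are finite and simple. The clique number $\omega(G)$ is the largest number of vertices in a clique of $G$. For a partition $\mathcal P$ of $V(G)$ and nonnegative edge weights $a=(a_e)_{e\in E(G)}$, the separated mass is $$W_{\mathcal P}(a):=\sum_{\substack{uv\in E(G)\\ u,\,v\text{ in different parts of }\mathcal P}} a_{uv},$$ where each (undirected) edge is counted once. *)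

theory Defs
  imports "HOL-Probability.Probability" "HOL-Library.Disjoint_Sets"
begin

text \<open>A finite simple graph is given by its vertex set and its set of edges, an (undirected) edge
  being the two-element set of its endpoints.\<close>

definition simple_graph :: "'a set \<Rightarrow> 'a set set \<Rightarrow> bool" where
  "simple_graph V E \<longleftrightarrow> finite V \<and> (\<forall>e\<in>E. \<exists>u\<in>V. \<exists>v\<in>V. u \<noteq> v \<and> e = {u, v})"

definition is_clique :: "'a set \<Rightarrow> 'a set set \<Rightarrow> 'a set \<Rightarrow> bool" where
  "is_clique V E C \<longleftrightarrow> C \<subseteq> V \<and> (\<forall>u\<in>C. \<forall>v\<in>C. u \<noteq> v \<longrightarrow> {u, v} \<in> E)"

definition clique_number :: "'a set \<Rightarrow> 'a set set \<Rightarrow> nat" where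
  "clique_number V E = Max (card ` {C. is_clique V E C})"

definition separated :: "'a set set \<Rightarrow> 'a set \<Rightarrow> bool" where
  "separated P e \<longleftrightarrow> (\<exists>A\<in>P. \<exists>B\<in>P. A \<noteq> B \<and> (\<exists>u\<in>A. \<exists>v\<in>B. e = {u, v}))"

definition separated_mass :: "'a set set \<Rightarrow> 'a set set \<Rightarrow> ('a set \<Rightarrow> real) \<Rightarrow> real" where
  "separated_mass E P a = (\<Sum>e\<in>{e\<in>E. separated P e}. a e)"

end

theory Submission
  imports Defs
begin

text \<open>
  Draw a random partition greedily: pick a uniformly random vertex \<open>v\<close>, make the set of its
  non-neighbours (including \<open>v\<close>) one part, and recurse inside its neighbourhood. The vertices
  picked form a clique, so there are at most \<open>\<omega>\<close> parts. Let \<open>p\<^sub>e\<close> be the probability that the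
  edge \<open>e\<close> is separated. By the Cauchy--Schwarz inequality it suffices to prove
  \<open>2 * (\<Sum>e\<in>E. 1 / p\<^sub>e) \<le> (1 - 1 / \<omega>) * n\<^sup>2\<close>.

  Put \<open>A(u) = n - (\<Sum>w\<sim>u. 1 / p\<^sub>u\<^sub>w)\<close>, so that the claim reads \<open>(\<Sum>u. A(u)) \<ge> n\<^sup>2 / \<omega>\<close>. The recursion
  for \<open>p\<close> yields \<open>A(u) * (n - A(u)) \<ge> (\<Sum>v\<sim>u. A\<^sub>v(u) / p\<^sub>u\<^sub>v\<^sup>2)\<close>, where \<open>A\<^sub>v\<close> belongs to the graph induced
  on the neighbourhood of \<open>v\<close>. With weights, \<open>(\<Sum>u. A(u) * g(u)\<^sup>2) \<ge> (\<Sum>u. g(u))\<^sup>2 / \<omega>\<close> then follows by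
  induction on \<open>\<omega>\<close>, applying the induction hypothesis in the neighbourhood of \<open>v\<close> to the weights
  \<open>g(u) / p\<^sub>u\<^sub>v\<close>.
\<close>

section \<open>Neighbourhoods and the greedy random partition\<close>

definition nbrs :: "'a set set \<Rightarrow> 'a \<Rightarrow> 'a set" where
  "nbrs E v = {w. w \<noteq> v \<and> {v, w} \<in> E}"

lemma nbrs_sym: "w \<in> nbrs E v \<longleftrightarrow> v \<in> nbrs E w"
  by (auto simp: nbrs_def insert_commute)

lemma not_in_nbrs_self [simp]: "v \<notin> nbrs E v"
  by (simp add: nbrs_def)

lemma link_psubset: "v \<in> H \<Longrightarrow> H \<inter> nbrs E v \<subset> H"
  using not_in_nbrs_self[of v E] by blast

text \<open>The guard \<open>v \<in> H\<close> only serves termination.\<close>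

function greedy :: "'a set set \<Rightarrow> 'a set \<Rightarrow> 'a set set pmf" where
  "greedy E H =
     (if finite H \<and> H \<noteq> {}
      then bind_pmf (pmf_of_set H) (\<lambda>v. if v \<in> H
             then map_pmf (insert (H - nbrs E v)) (greedy E (H \<inter> nbrs E v))
             else return_pmf {})
      else return_pmf {})"
  by pat_completeness auto
termination
  by (relation "Wellfounded.measure (\<lambda>(E, H). card H)") (auto intro!: psubset_card_mono link_psubset)

declare greedy.simps [simp del]

lemma greedy_rec:
  assumes "finite H" "H \<noteq> {}"
  shows "greedy E H = bind_pmf (pmf_of_set H)
           (\<lambda>v. map_pmf (insert (H - nbrs E v)) (greedy E (H \<inter> nbrs E v)))"
proof -
  have "v \<in> H" if "v \<in> set_pmf (pmf_of_set H)" for v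
    using that assms by simp
  then have "bind_pmf (pmf_of_set H) (\<lambda>v. if v \<in> H then f v else return_pmf {})
      = bind_pmf (pmf_of_set H) f" for f :: "'a \<Rightarrow> 'a set set pmf"
    by (intro bind_pmf_cong refl) simp
  then show ?thesis
    using assms by (subst greedy.simps) simp
qed

lemma set_pmf_greedy:
  assumes "finite H" "H \<noteq> {}"
  shows "set_pmf (greedy E H) =
           (\<Union>v\<in>H. insert (H - nbrs E v) ` set_pmf (greedy E (H \<inter> nbrs E v)))"
  using assms by (simp add: greedy_rec)

text \<open>Finite support makes every real function integrable, so expectations can be split and
  compared freely below.\<close>

lemma finite_set_pmf_greedy:
  assumes "finite H"
  shows "finite (set_pmf (greedy E H))"
  using assms
proof (induction H rule: finite_psubset_induct)
  case (psubset H)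
  show ?case
  proof (cases "H = {}")
    case True
    then show ?thesis by (simp add: greedy.simps)
  next
    case False
    then show ?thesis
      using psubset.IH psubset.hyps link_psubset[of _ H E] by (simp add: set_pmf_greedy)
  qed
qed

lemma greedy_partition_clique:
  assumes "finite H" "P \<in> set_pmf (greedy E H)"
  shows "partition_on H P \<and> (\<exists>C. is_clique H E C \<and> card C = card P)"
  using assms
proof (induction H arbitrary: P rule: finite_psubset_induct)
  case (psubset H)
  show ?case
  proof (cases "H = {}")
    case True
    then show ?thesis
      using psubset.prems by (auto simp: greedy.simps partition_on_def is_clique_def)
  next
    case False
    then obtain v P' where v: "v \<in> H" and P': "P' \<in> set_pmf (greedy E (H \<inter> nbrs E v))"
      and P: "P = insert (H - nbrs E v) P'"
      using psubset.prems psubset.hyps by (auto simp: set_pmf_greedy)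
    from psubset.IH[OF link_psubset[OF v] P'] obtain C where part: "partition_on (H \<inter> nbrs E v) P'"
      and C: "is_clique (H \<inter> nbrs E v) E C" "card C = card P'"
      by blast
    have fin: "finite P'" "finite C"
      using finite_elements[OF _ part] C psubset.hyps by (auto simp: is_clique_def dest: finite_subset)
    \<comment> \<open>The new part contains \<open>v\<close>, which no part of \<open>P'\<close> can
      contain; hence parts and picked vertices both grow by exactly one.\<close>
    have "H - nbrs E v \<notin> P'"
      using partition_onD1[OF part] v not_in_nbrs_self[of v E] by blast
    moreover have "v \<notin> C" using C by (auto simp: is_clique_def)
    ultimately have "card (insert v C) = card P"
      using fin C P by simp
    moreover have "is_clique H E (insert v C)"
      using C v by (auto simp: is_clique_def nbrs_def insert_commute)
    moreover have "partition_on H P"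
      unfolding P using part v
      by (auto simp: partition_on_def disjoint_def)
    ultimately show ?thesis by blast
  qed
qed

section \<open>Separation probabilities and their recursion\<close>

definition sep_prob :: "'a set set \<Rightarrow> 'a set \<Rightarrow> 'a set \<Rightarrow> real" where
  "sep_prob E H e = measure_pmf.expectation (greedy E H) (\<lambda>P. of_bool (separated P e))"

lemma sep_prob_eq: "sep_prob E H e = measure_pmf.prob (greedy E H) {P. separated P e}"
proof -
  have "(\<lambda>P. of_bool (separated P e)) = (indicator {P. separated P e} :: 'a set set \<Rightarrow> real)"
    by (auto simp: indicator_def)
  then show ?thesis by (simp add: sep_prob_def)
qed

lemma sep_prob_le_1: "sep_prob E H e \<le> 1"
  by (simp add: sep_prob_eq)

lemma sep_prob_nonneg: "0 \<le> sep_prob E H e"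
  by (simp add: sep_prob_eq)

lemma separated_insert: "separated P e \<Longrightarrow> separated (insert A P) e"
  unfolding separated_def by blast

text \<open>Condition on the first pick \<open>v\<close>. If exactly one of \<open>u\<close>,
  \<open>w\<close> is a neighbour of \<open>v\<close>, the pair is separated at once; if both are,
  the choice is left to the recursive call. The remaining picks contribute a nonnegative amount,
  which is dropped.\<close>

lemma sep_prob_recursion:
  assumes fin: "finite H" and u: "u \<in> H" and w: "w \<in> H"
  shows "card H * sep_prob E H {u, w} \<ge>
           real (card (H \<inter> nbrs E u - nbrs E w)) + real (card (H \<inter> nbrs E w - nbrs E u))
           + (\<Sum>t\<in>H \<inter> nbrs E u \<inter> nbrs E w. sep_prob E (H \<inter> nbrs E t) {u, w})"
proof -
  let ?N = "nbrs E"
  \<comment> \<open>\<open>q v\<close> is the probability of separation given that \<open>v\<close>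
    is picked first.\<close>
  define q where "q v = measure_pmf.expectation
    (map_pmf (insert (H - ?N v)) (greedy E (H \<inter> ?N v))) (\<lambda>P. of_bool (separated P {u, w}) :: real)" for v
  have "H \<noteq> {}" using u by auto
  then have "sep_prob E H {u, w} = (\<Sum>v\<in>H. q v /\<^sub>R card H)"
    unfolding sep_prob_def q_def greedy_rec[OF fin \<open>H \<noteq> {}\<close>]
    using fin by (intro pmf_expectation_bind_pmf_of_set) (simp_all add: finite_set_pmf_greedy)
  also have "\<dots> = (\<Sum>v\<in>H. q v) / card H"
    by (simp only: scaleR_sum_right[symmetric]) (simp add: divide_inverse_commute)
  finally have eq: "card H * sep_prob E H {u, w} = (\<Sum>v\<in>H. q v)"
    using \<open>H \<noteq> {}\<close> fin by simp
  have q_nonneg: "q v \<ge> 0" for v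
    unfolding q_def by (intro integral_nonneg_AE) auto
  have int: "integrable (measure_pmf (greedy E (H \<inter> ?N v))) f" for v and f :: "'a set set \<Rightarrow> real"
    using fin by (intro integrable_measure_pmf_finite finite_set_pmf_greedy) auto
  have one: "q v = 1" if v: "v \<in> H" and xor: "(u \<in> ?N v) \<noteq> (w \<in> ?N v)" for v
  proof -
    have "separated (insert (H - ?N v) P) {u, w}" if P: "P \<in> set_pmf (greedy E (H \<inter> ?N v))" for P
    proof -
      have part: "partition_on (H \<inter> ?N v) P"
        using greedy_partition_clique[OF _ P] fin by auto
      have *: "separated (insert (H - ?N v) P) {a, b}"
        if ab: "a \<in> H \<inter> ?N v" "b \<in> H - ?N v" for a b
      proof -
        obtain B where "B \<in> P" "a \<in> B"
          using partition_onD1[OF part] ab by auto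
        moreover from this have "B \<noteq> H - ?N v" using ab by auto
        ultimately show ?thesis
          unfolding separated_def using ab
          by (intro bexI[of _ B] bexI[of _ "H - ?N v"] conjI bexI[of _ a] bexI[of _ b]) auto
      qed
      show ?thesis
      proof (cases "u \<in> ?N v")
        case True
        then show ?thesis using xor u w by (intro *) auto
      next
        case False
        then have "separated (insert (H - ?N v) P) {w, u}" using xor u w by (intro *) auto
        then show ?thesis by (simp only: insert_commute)
      qed
    qed
    then have "q v = measure_pmf.expectation (greedy E (H \<inter> ?N v)) (\<lambda>_. 1)"
      unfolding q_def integral_map_pmf by (intro integral_cong_AE) (auto simp: AE_measure_pmf_iff)
    then show ?thesis by simp
  qed
  have inner: "q v \<ge> sep_prob E (H \<inter> ?N v) {u, w}" for v
    unfolding q_def sep_prob_def integral_map_pmf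
    by (intro integral_mono int) (auto simp: separated_insert)
  let ?A = "H \<inter> ?N u - ?N w" and ?B = "H \<inter> ?N w - ?N u" and ?C = "H \<inter> ?N u \<inter> ?N w"
  have "real (card ?A) + real (card ?B) + (\<Sum>t\<in>?C. sep_prob E (H \<inter> ?N t) {u, w})
      \<le> (\<Sum>v\<in>?A. q v) + (\<Sum>v\<in>?B. q v) + (\<Sum>v\<in>?C. q v)"
  proof (intro add_mono sum_mono inner)
    have "q v = 1" if "v \<in> ?A \<union> ?B" for v
      using that nbrs_sym[of u E v] nbrs_sym[of w E v] by (intro one) auto
    then have "(\<Sum>v\<in>?A. q v) = (\<Sum>v\<in>?A. 1)" "(\<Sum>v\<in>?B. q v) = (\<Sum>v\<in>?B. 1)"
      by (auto intro!: sum.cong)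
    then show "card ?A \<le> (\<Sum>v\<in>?A. q v)" "card ?B \<le> (\<Sum>v\<in>?B. q v)" by simp_all
  qed
  also have "\<dots> = (\<Sum>v\<in>?A \<union> ?B \<union> ?C. q v)"
  proof -
    have "(\<Sum>v\<in>?A \<union> ?B. q v) = (\<Sum>v\<in>?A. q v) + (\<Sum>v\<in>?B. q v)"
      using fin by (intro sum.union_disjoint) auto
    moreover have "(\<Sum>v\<in>?A \<union> ?B \<union> ?C. q v) = (\<Sum>v\<in>?A \<union> ?B. q v) + (\<Sum>v\<in>?C. q v)"
      using fin by (intro sum.union_disjoint) auto
    ultimately show ?thesis by simp
  qed
  also have "\<dots> \<le> (\<Sum>v\<in>H. q v)"
    using fin q_nonneg by (intro sum_mono2) auto
  finally show ?thesis using eq by simp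
qed

lemma sep_prob_pos:
  assumes "finite H" "u \<in> H" "w \<in> H \<inter> nbrs E u"
  shows "0 < sep_prob E H {u, w}"
proof -
  \<comment> \<open>Picking \<open>w\<close> itself first separates the pair, since \<open>w\<close>
    is adjacent to \<open>u\<close> but not to itself.\<close>
  have "w \<in> H \<inter> nbrs E u - nbrs E w" using assms by auto
  then have "0 < card (H \<inter> nbrs E u - nbrs E w)"
    using assms by (auto simp: card_gt_0_iff)
  then have "0 < card H * sep_prob E H {u, w}"
    using sep_prob_recursion[OF assms(1,2), of w E] assms(3)
      sum_nonneg[of "H \<inter> nbrs E u \<inter> nbrs E w" "\<lambda>t. sep_prob E (H \<inter> nbrs E t) {u, w}"]
    by (auto simp: sep_prob_nonneg)
  then show ?thesis by (simp add: zero_less_mult_iff)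
qed

section \<open>The quantity A(u) of the overview, for the graph induced on \<open>H\<close>, and its
  recursion\<close>

definition excess :: "'a set set \<Rightarrow> 'a set \<Rightarrow> 'a \<Rightarrow> real" where
  "excess E H u = card H - (\<Sum>w\<in>H \<inter> nbrs E u. 1 / sep_prob E H {u, w})"

text \<open>The two bracketed factors have product at least 1, so AM-GM applies. It serves two
  adjacent neighbours \<open>v\<close>, \<open>w\<close> of \<open>u\<close>, with \<open>q\<close>
  and \<open>s\<close> the separation probabilities of \<open>{u, v}\<close> in the link of
  \<open>w\<close> and of \<open>{u, w}\<close> in the link of \<open>v\<close>.\<close>

lemma weighted_am_gm_link:
  fixes a b q s :: real
  assumes "0 < q" "q \<le> 1" "0 < s" "s \<le> 1" "0 \<le> a" "0 \<le> b"
  shows "2 * a * b \<le> a\<^sup>2 * (q + 1 / s - 1) + b\<^sup>2 * (s + 1 / q - 1)"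
proof -
  define F G where "F = q + 1 / s - 1" and "G = s + 1 / q - 1"
  have "F > 0" "G > 0"
    using assms by (simp_all add: F_def G_def add_strict_increasing2 le_divide_eq_1_pos add_pos_nonneg add_diff_eq[symmetric])
  have "F * G = 1 + (1 - q) * (1 - s) + (1 / q - 1) * (1 / s - 1)"
    using assms by (simp add: F_def G_def field_simps)
  moreover have "(1 - q) * (1 - s) \<ge> 0" "(1 / q - 1) * (1 / s - 1) \<ge> 0"
    using assms by (auto intro!: mult_nonneg_nonneg)
  ultimately have "1 \<le> F * G" by linarith
  have "(a * b)\<^sup>2 \<le> (a * b)\<^sup>2 * (F * G)"
    using mult_left_mono[OF \<open>1 \<le> F * G\<close>, of "(a * b)\<^sup>2"] by simp
  also have "\<dots> = (a\<^sup>2 * F) * (b\<^sup>2 * G)" by (simp add: power_mult_distrib)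
  finally have "a * b \<le> sqrt ((a\<^sup>2 * F) * (b\<^sup>2 * G))"
    by (rule real_le_rsqrt)
  also have "\<dots> \<le> (a\<^sup>2 * F + b\<^sup>2 * G) / 2"
    using \<open>F > 0\<close> \<open>G > 0\<close> by (intro arith_geo_mean_sqrt) auto
  finally show ?thesis by (simp add: F_def G_def)
qed

text \<open>With S the sum of \<open>b v\<close> = 1 / p_uv over the neighbours of \<open>u\<close>,
  A(u) = n - S, so the right side is n S - S^2. It remains to bound S^2: expand it over pairs,
  distribute each cross term by \<open>pair\<close>, and sum the shares of each \<open>v\<close> by
  \<open>step\<close>.\<close>

lemma excess_recursion:
  assumes fin: "finite H" and u: "u \<in> H"
  shows "(\<Sum>v\<in>H \<inter> nbrs E u. excess E (H \<inter> nbrs E v) u / (sep_prob E H {u, v})\<^sup>2)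
           \<le> excess E H u * (card H - excess E H u)"
proof -
  let ?N = "nbrs E"
  define U where "U = H \<inter> ?N u"
  define b where "b v = 1 / sep_prob E H {u, v}" for v
  \<comment> \<open>\<open>F v w\<close> is the coefficient of \<open>(b v)\<^sup>2\<close> in the
    share of the pair that is charged to \<open>v\<close>. It is chosen so that its sum over
    \<open>w\<close> is what the recursion for \<open>{u, v}\<close> controls.\<close>
  define F where "F v w = (if w \<in> ?N v
      then sep_prob E (H \<inter> ?N w) {u, v} + 1 / sep_prob E (H \<inter> ?N v) {u, w} - 1 else 1)" for v w
  have finU: "finite U" using fin by (simp add: U_def)
  have b_pos: "b v > 0" if "v \<in> U" for v
    using sep_prob_pos[OF fin u, of v E] that by (simp add: b_def U_def)
  have step: "(b v)\<^sup>2 * (\<Sum>w\<in>U. F v w) \<le> card H * b v - (b v)\<^sup>2 * excess E (H \<inter> ?N v) u"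
    if v: "v \<in> U" for v
  proof -
    have "v \<in> H" and uv: "u \<in> H \<inter> ?N v" using v u nbrs_sym[of u E v] by (auto simp: U_def)
    have split: "U = (U - ?N v) \<union> (U \<inter> ?N v)" by auto
    have "(\<Sum>w\<in>U. F v w) = (\<Sum>w\<in>U - ?N v. F v w) + (\<Sum>w\<in>U \<inter> ?N v. F v w)"
      using finU by (subst split, subst sum.union_disjoint) auto
    also have "\<dots> = card (U - ?N v) + (\<Sum>w\<in>U \<inter> ?N v. sep_prob E (H \<inter> ?N w) {u, v})
        + (\<Sum>w\<in>U \<inter> ?N v. 1 / sep_prob E (H \<inter> ?N v) {u, w}) - card (U \<inter> ?N v)"
      by (simp add: F_def sum.distrib sum_subtractf)
    \<comment> \<open>The recursion bounds the first two terms by n p_uv minus the number of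
      vertices in \<open>H \<inter> ?N v - ?N u\<close>. The last two terms equal that same number
      minus A_v(u), so it cancels.\<close>
    also have "\<dots> \<le> card H * sep_prob E H {u, v} - excess E (H \<inter> ?N v) u"
    proof -
      have "H \<inter> ?N v = (H \<inter> ?N v - ?N u) \<union> (U \<inter> ?N v)" by (auto simp: U_def)
      then have "card (H \<inter> ?N v) = card (H \<inter> ?N v - ?N u) + card (U \<inter> ?N v)"
        using fin finU card_Un_disjoint[of "H \<inter> ?N v - ?N u" "U \<inter> ?N v"] by (simp add: U_def disjoint_iff)
      moreover have "H \<inter> ?N v \<inter> ?N u = U \<inter> ?N v" by (auto simp: U_def)
      ultimately show ?thesis
        using sep_prob_recursion[OF fin u \<open>v \<in> H\<close>, of E]
        by (simp add: excess_def U_def)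
    qed
    finally have "(b v)\<^sup>2 * (\<Sum>w\<in>U. F v w)
        \<le> (b v)\<^sup>2 * (card H * sep_prob E H {u, v} - excess E (H \<inter> ?N v) u)"
      by (intro mult_left_mono) auto
    moreover have "(b v)\<^sup>2 * sep_prob E H {u, v} = b v"
      using b_pos[OF v] by (simp add: b_def power2_eq_square)
    ultimately show ?thesis by (simp add: algebra_simps)
  qed
  have pair: "2 * b v * b w \<le> (b v)\<^sup>2 * F v w + (b w)\<^sup>2 * F w v" if vw: "v \<in> U" "w \<in> U" for v w
  proof (cases "w \<in> ?N v")
    case True
    have "0 < sep_prob E (H \<inter> ?N w) {u, v}" "0 < sep_prob E (H \<inter> ?N v) {u, w}"
      using True vw u fin nbrs_sym[of u E v] nbrs_sym[of u E w] nbrs_sym[of v E w]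
      by (simp_all add: sep_prob_pos U_def)
    then show ?thesis
      using weighted_am_gm_link[of "sep_prob E (H \<inter> ?N w) {u, v}" "sep_prob E (H \<inter> ?N v) {u, w}" "b v" "b w"]
        True nbrs_sym[of v E w] b_pos[OF vw(1)] b_pos[OF vw(2)] by (simp add: F_def sep_prob_le_1)
  next
    \<comment> \<open>This case includes \<open>v = w\<close>; both coefficients are 1.\<close>
    case False
    then show ?thesis
      using sum_squares_bound[of "b v" "b w"] nbrs_sym[of v E w] by (simp add: F_def)
  qed
  have "2 * (\<Sum>v\<in>U. b v)\<^sup>2 = (\<Sum>v\<in>U. \<Sum>w\<in>U. 2 * b v * b w)"
    unfolding power2_eq_square sum_product by (simp add: sum_distrib_left mult.assoc)
  also have "\<dots> \<le> (\<Sum>v\<in>U. \<Sum>w\<in>U. (b v)\<^sup>2 * F v w + (b w)\<^sup>2 * F w v)"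
    by (intro sum_mono pair)
  also have "\<dots> = 2 * (\<Sum>v\<in>U. (b v)\<^sup>2 * (\<Sum>w\<in>U. F v w))"
    using sum.swap[of "\<lambda>v w. (b w)\<^sup>2 * F w v" U U] by (simp add: sum.distrib sum_distrib_left)
  also have "\<dots> \<le> 2 * (\<Sum>v\<in>U. card H * b v - (b v)\<^sup>2 * excess E (H \<inter> ?N v) u)"
    by (intro mult_left_mono sum_mono step) auto
  finally have "(\<Sum>v\<in>U. b v)\<^sup>2
      \<le> card H * (\<Sum>v\<in>U. b v) - (\<Sum>v\<in>U. (b v)\<^sup>2 * excess E (H \<inter> ?N v) u)"
    by (simp add: sum_subtractf flip: sum_distrib_left)
  moreover have "excess E H u = card H - (\<Sum>v\<in>U. b v)"
    by (simp add: excess_def U_def b_def)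
  moreover have "(\<Sum>v\<in>U. (b v)\<^sup>2 * excess E (H \<inter> ?N v) u)
      = (\<Sum>v\<in>U. excess E (H \<inter> ?N v) u / (sep_prob E H {u, v})\<^sup>2)"
    by (simp add: b_def power_divide)
  ultimately show ?thesis
    by (simp add: U_def right_diff_distrib left_diff_distrib power2_eq_square)
qed

section \<open>The weighted lower bound on the excess\<close>

lemma square_sum_weighted:
  fixes x y :: real
  assumes "0 < k"
  shows "(x + y)\<^sup>2 / (k + 1) \<le> x\<^sup>2 + y\<^sup>2 / k"
proof -
  have "k * (x + y)\<^sup>2 \<le> (k + 1) * (k * x\<^sup>2 + y\<^sup>2)"
    using zero_le_power2[of "k * x - y"] by (simp add: power2_eq_square algebra_simps)
  then show ?thesis using assms by (simp add: field_simps)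
qed

text \<open>The weights \<open>g\<close> must be arbitrary for the induction: each vertex
  \<open>v\<close> needs the hypothesis in its link with its own weights \<open>b u v * g u\<close>.
  Cliques in the link extend by \<open>v\<close>, which lowers the clique bound by one.\<close>

lemma weighted_excess_bound:
  assumes "finite H" "\<And>C. is_clique H E C \<Longrightarrow> card C \<le> Suc k"
  shows "(\<Sum>u\<in>H. g u)\<^sup>2 / Suc k \<le> (\<Sum>u\<in>H. excess E H u * (g u)\<^sup>2)"
  using assms
proof (induction k arbitrary: H g)
  case 0
  have "H \<inter> nbrs E u = {}" if "u \<in> H" for u
  proof (rule ccontr)
    assume "H \<inter> nbrs E u \<noteq> {}"
    then obtain w where w: "w \<in> H" "w \<in> nbrs E u" by auto
    then have "is_clique H E {u, w}"
      using that by (auto simp: is_clique_def nbrs_def insert_commute)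
    then show False using "0.prems"(2)[of "{u, w}"] w by (auto simp: nbrs_def)
  qed
  \<comment> \<open>Without edges every excess equals \<open>card H\<close>, and the claim is
    Cauchy-Schwarz.\<close>
  then have "(\<Sum>u\<in>H. excess E H u * (g u)\<^sup>2) = card H * (\<Sum>u\<in>H. (g u)\<^sup>2)"
    by (simp add: excess_def sum_distrib_left)
  then show ?case
    using Cauchy_Schwarz_ineq_sum[of "\<lambda>_. 1" g H] by simp
next
  case (Suc k)
  let ?N = "nbrs E"
  note fin = Suc.prems(1)
  define n where "n = real (card H)"
  define b where "b u v = 1 / sep_prob E H {u, v}" for u v
  define h where "h v = (\<Sum>u\<in>H \<inter> ?N v. b u v * g u)" for v
  have swap: "(\<Sum>u\<in>H. \<Sum>v\<in>H \<inter> ?N u. f u v) = (\<Sum>v\<in>H. \<Sum>u\<in>H \<inter> ?N v. f u v)"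
    for f :: "'a \<Rightarrow> 'a \<Rightarrow> real"
  proof -
    have "(\<Sum>u\<in>H. \<Sum>v\<in>H \<inter> ?N u. f u v) = (\<Sum>u\<in>H. \<Sum>v\<in>{v. v \<in> H \<and> v \<in> ?N u}. f u v)"
      by (simp add: Int_def)
    also have "\<dots> = (\<Sum>v\<in>H. \<Sum>u\<in>{u. u \<in> H \<and> v \<in> ?N u}. f u v)"
      by (rule sum.swap_restrict[OF fin fin])
    also have "\<dots> = (\<Sum>v\<in>H. \<Sum>u\<in>H \<inter> ?N v. f u v)"
    proof (rule sum.cong[OF refl])
      fix v
      have "{u. u \<in> H \<and> v \<in> ?N u} = H \<inter> ?N v" by (simp add: nbrs_sym[of v] Int_def)
      then show "(\<Sum>u\<in>{u. u \<in> H \<and> v \<in> ?N u}. f u v) = (\<Sum>u\<in>H \<inter> ?N v. f u v)" by simp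
    qed
    finally show ?thesis .
  qed
  show ?case
  proof (cases "H = {}")
    case False
    have "n > 0" using False fin by (simp add: n_def card_gt_0_iff)
    have link: "(h v)\<^sup>2 / Suc k \<le> (\<Sum>u\<in>H \<inter> ?N v. excess E (H \<inter> ?N v) u * (b u v * g u)\<^sup>2)"
      if v: "v \<in> H" for v
      unfolding h_def
    proof (rule Suc.IH)
      show "finite (H \<inter> ?N v)" using fin by simp
      fix C assume C: "is_clique (H \<inter> ?N v) E C"
      then have "is_clique H E (insert v C)"
        using v by (auto simp: is_clique_def nbrs_def insert_commute)
      moreover have "v \<notin> C" "finite C"
        using C fin by (auto simp: is_clique_def dest: finite_subset)
      ultimately show "card C \<le> Suc k" using Suc.prems(2)[of "insert v C"] by simp
    qed
    have "(\<Sum>v\<in>H. h v) = (\<Sum>u\<in>H. \<Sum>v\<in>H \<inter> ?N u. b u v * g u)"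
      unfolding h_def by (rule swap[symmetric])
    also have "\<dots> = (\<Sum>u\<in>H. (n - excess E H u) * g u)"
      by (simp add: excess_def n_def b_def sum_distrib_right)
    \<comment> \<open>Each \<open>u\<close> passes \<open>b u v * g u\<close> to every neighbour
      \<open>v\<close>, in total (n - A(u)) g(u); together with the retained A(u) g(u) this makes n
      g(u).\<close>
    finally have total: "(\<Sum>v\<in>H. excess E H v * g v + h v) = n * (\<Sum>u\<in>H. g u)"
      by (simp add: sum.distrib sum_subtractf sum_distrib_left algebra_simps)
    have "(\<Sum>v\<in>H. (h v)\<^sup>2 / Suc k)
        \<le> (\<Sum>v\<in>H. \<Sum>u\<in>H \<inter> ?N v. excess E (H \<inter> ?N v) u * (b u v * g u)\<^sup>2)"
      by (intro sum_mono link)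
    also have "\<dots> = (\<Sum>u\<in>H. \<Sum>v\<in>H \<inter> ?N u. excess E (H \<inter> ?N v) u * (b u v * g u)\<^sup>2)"
      by (rule swap[symmetric])
    also have "\<dots> = (\<Sum>u\<in>H. (\<Sum>v\<in>H \<inter> ?N u. excess E (H \<inter> ?N v) u / (sep_prob E H {u, v})\<^sup>2) * (g u)\<^sup>2)"
      by (simp add: b_def sum_distrib_right power_mult_distrib power_divide)
    also have "\<dots> \<le> (\<Sum>u\<in>H. (excess E H u * (n - excess E H u)) * (g u)\<^sup>2)"
      unfolding n_def by (intro sum_mono mult_right_mono excess_recursion fin) auto
    finally have rec: "(\<Sum>v\<in>H. (h v)\<^sup>2 / Suc k)
        \<le> n * (\<Sum>u\<in>H. excess E H u * (g u)\<^sup>2) - (\<Sum>u\<in>H. (excess E H u * g u)\<^sup>2)"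
      by (simp add: sum_subtractf sum_distrib_left algebra_simps power2_eq_square)
    have "(n * (\<Sum>u\<in>H. g u))\<^sup>2 \<le> n * (\<Sum>v\<in>H. (excess E H v * g v + h v)\<^sup>2)"
      using Cauchy_Schwarz_ineq_sum[of "\<lambda>_. 1" "\<lambda>v. excess E H v * g v + h v" H]
      by (simp add: total n_def)
    then have "n * (\<Sum>u\<in>H. g u)\<^sup>2 \<le> (\<Sum>v\<in>H. (excess E H v * g v + h v)\<^sup>2)"
      using \<open>n > 0\<close> by (simp add: power_mult_distrib power2_eq_square mult.assoc mult.left_commute)
    then have "n * (\<Sum>u\<in>H. g u)\<^sup>2 / Suc (Suc k)
        \<le> (\<Sum>v\<in>H. (excess E H v * g v + h v)\<^sup>2) / Suc (Suc k)"
      by (intro divide_right_mono) auto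
    \<comment> \<open>The denominator k + 2 splits as 1 + (k + 1): the retained part gets weight 1,
      and \<open>h v\<close> gets the weight from the induction hypothesis. The squares of the
      retained parts then cancel against those subtracted in \<open>rec\<close>.\<close>
    also have "\<dots> \<le> (\<Sum>v\<in>H. (excess E H v * g v)\<^sup>2 + (h v)\<^sup>2 / Suc k)"
      unfolding sum_divide_distrib
    proof (rule sum_mono)
      fix v
      show "(excess E H v * g v + h v)\<^sup>2 / Suc (Suc k) \<le> (excess E H v * g v)\<^sup>2 + (h v)\<^sup>2 / Suc k"
        using square_sum_weighted[of "real (Suc k)" "excess E H v * g v" "h v"]
        by (simp add: add.commute[of _ "real _"])
    qed
    also have "\<dots> \<le> n * (\<Sum>u\<in>H. excess E H u * (g u)\<^sup>2)"
      using rec by (simp add: sum.distrib)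
    finally have "n * ((\<Sum>u\<in>H. g u)\<^sup>2 / Suc (Suc k)) \<le> n * (\<Sum>u\<in>H. excess E H u * (g u)\<^sup>2)"
      by simp
    then show ?thesis using \<open>n > 0\<close> by (simp only: mult_le_cancel_left_pos)
  qed simp
qed

section \<open>From vertex sums to edge sums, and the final estimate\<close>

lemma sum_nbrs_eq_twice_sum_edges:
  fixes f :: "'a set \<Rightarrow> real"
  assumes "simple_graph V E"
  shows "(\<Sum>u\<in>V. \<Sum>w\<in>V \<inter> nbrs E u. f {u, w}) = 2 * (\<Sum>e\<in>E. f e)"
proof -
  have fin: "finite V" and edge: "\<And>e. e \<in> E \<Longrightarrow> \<exists>u\<in>V. \<exists>v\<in>V. u \<noteq> v \<and> e = {u, v}"
    using assms by (auto simp: simple_graph_def)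
  define S where "S = (SIGMA u:V. V \<inter> nbrs E u)"
  have finS: "finite S" using fin by (simp add: S_def)
  have finE: "finite E"
    using edge by (intro finite_subset[OF _ finite_Pow_iff[THEN iffD2, OF fin]]) blast
  have "(\<Sum>u\<in>V. \<Sum>w\<in>V \<inter> nbrs E u. f {u, w}) = (\<Sum>z\<in>S. f {fst z, snd z})"
    using fin by (simp add: S_def sum.Sigma case_prod_unfold)
  also have "\<dots> = (\<Sum>e\<in>E. \<Sum>z\<in>{z \<in> S. {fst z, snd z} = e}. f {fst z, snd z})"
    using finS finE by (intro sum.group[symmetric]) (auto simp: S_def nbrs_def)
  also have "\<dots> = (\<Sum>e\<in>E. 2 * f e)"
  proof (rule sum.cong[OF refl])
    fix e assume e: "e \<in> E"
    then obtain u v where uv: "u \<in> V" "v \<in> V" "u \<noteq> v" "e = {u, v}" using edge by blast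
    then have "{z \<in> S. {fst z, snd z} = e} = {(u, v), (v, u)}"
      using e by (auto simp: S_def nbrs_def doubleton_eq_iff insert_commute)
    then show "(\<Sum>z\<in>{z \<in> S. {fst z, snd z} = e}. f {fst z, snd z}) = 2 * f e"
      using uv by (simp add: insert_commute)
  qed
  finally show ?thesis by (simp add: sum_distrib_left)
qed

lemma sum_sqrt_squared_le:
  fixes a p :: "'b \<Rightarrow> real"
  assumes "\<And>e. e \<in> S \<Longrightarrow> 0 < p e" "\<And>e. e \<in> S \<Longrightarrow> 0 \<le> a e"
  shows "(\<Sum>e\<in>S. sqrt (a e))\<^sup>2 \<le> (\<Sum>e\<in>S. a e * p e) * (\<Sum>e\<in>S. 1 / p e)"
proof -
  \<comment> \<open>This factorisation is the one to which Cauchy-Schwarz is applied.\<close>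
  have "(\<Sum>e\<in>S. sqrt (a e)) = (\<Sum>e\<in>S. sqrt (a e * p e) * sqrt (1 / p e))"
  proof (rule sum.cong[OF refl])
    fix e assume "e \<in> S"
    then have "p e \<noteq> 0" using assms(1)[of e] by simp
    then show "sqrt (a e) = sqrt (a e * p e) * sqrt (1 / p e)"
      by (simp flip: real_sqrt_mult)
  qed
  moreover have "(\<Sum>e\<in>S. (sqrt (a e * p e))\<^sup>2) = (\<Sum>e\<in>S. a e * p e)"
    and "(\<Sum>e\<in>S. (sqrt (1 / p e))\<^sup>2) = (\<Sum>e\<in>S. 1 / p e)"
    using assms by (auto intro!: sum.cong simp: less_imp_le)
  ultimately show ?thesis
    using Cauchy_Schwarz_ineq_sum[of "\<lambda>e. sqrt (a e * p e)" "\<lambda>e. sqrt (1 / p e)" S] by simp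
qed

theorem theorem1p3:
  fixes V :: "'a set" and E :: "'a set set" and n \<omega> :: nat
  assumes "simple_graph V E"
    and "E \<noteq> {}"
    and "n = card V"
    and "\<omega> = clique_number V E"
  shows "\<exists>D :: 'a set set pmf.
    (\<forall>P\<in>set_pmf D. partition_on V P \<and> card P \<le> \<omega>) \<and>
    (\<forall>a :: 'a set \<Rightarrow> real. (\<forall>e\<in>E. 0 \<le> a e) \<longrightarrow>
      measure_pmf.expectation D (\<lambda>P. separated_mass E P a)
        \<ge> 2 / ((1 - 1 / real \<omega>) * (real n)\<^sup>2) * (\<Sum>e\<in>E. sqrt (a e))\<^sup>2)"
proof (intro exI[of _ "greedy E V"] conjI ballI allI impI)
  have fin: "finite V" and edge: "\<And>e. e \<in> E \<Longrightarrow> \<exists>u\<in>V. \<exists>v\<in>V. u \<noteq> v \<and> e = {u, v}"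
    using assms(1) by (auto simp: simple_graph_def)
  have finE: "finite E"
    using edge by (intro finite_subset[OF _ finite_Pow_iff[THEN iffD2, OF fin]]) blast
  have clique_le: "card C \<le> \<omega>" if "is_clique V E C" for C
  proof -
    have "finite {C. is_clique V E C}"
      using fin by (auto simp: is_clique_def intro: finite_subset[of _ "Pow V"])
    then show ?thesis using that by (simp add: assms(4) clique_number_def)
  qed
  obtain e0 where "e0 \<in> E" using assms(2) by auto
  with edge[OF this] obtain u0 v0 where e0: "{u0, v0} \<in> E" "u0 \<in> V" "v0 \<in> V" "u0 \<noteq> v0"
    by auto
  then have "is_clique V E {u0, v0}" by (auto simp: is_clique_def insert_commute)
  \<comment> \<open>An edge forces \<open>\<omega> \<ge> 2\<close>, so 1 - 1/\<omega> is positive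
    and the last step may divide by it.\<close>
  from clique_le[OF this] have "\<omega> \<ge> 2" using e0 by simp
  have "n > 0" using e0 fin assms(3) by (auto simp: card_gt_0_iff)
  {
    fix P assume P: "P \<in> set_pmf (greedy E V)"
    show "partition_on V P" and "card P \<le> \<omega>"
      using greedy_partition_clique[OF fin P] by (auto, metis clique_le)
  }
  fix a :: "'a set \<Rightarrow> real" assume "\<forall>e\<in>E. 0 \<le> a e"
  then have a: "\<And>e. e \<in> E \<Longrightarrow> 0 \<le> a e" by blast
  have pos: "0 < sep_prob E V e" if e: "e \<in> E" for e
  proof -
    obtain u v where "u \<in> V" "v \<in> V" "u \<noteq> v" "e = {u, v}" using edge[OF e] by blast
    then show ?thesis using sep_prob_pos[OF fin, of u v E] e by (simp add: nbrs_def)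
  qed
  obtain k where k: "\<omega> = Suc k" using \<open>\<omega> \<ge> 2\<close> by (cases \<omega>) auto
  \<comment> \<open>Constant weights 1 turn the weighted bound into a bound on the sum of all
    excesses.\<close>
  have "(real n)\<^sup>2 / \<omega> \<le> (\<Sum>u\<in>V. excess E V u)"
    using weighted_excess_bound[OF fin, of E k "\<lambda>_. 1"] clique_le by (simp add: k assms(3))
  also have "\<dots> = (real n)\<^sup>2 - 2 * (\<Sum>e\<in>E. 1 / sep_prob E V e)"
    using sum_nbrs_eq_twice_sum_edges[OF assms(1), of "\<lambda>e. 1 / sep_prob E V e"]
    by (simp add: excess_def sum_subtractf assms(3) power2_eq_square)
  finally have bound: "2 * (\<Sum>e\<in>E. 1 / sep_prob E V e) \<le> (1 - 1 / real \<omega>) * (real n)\<^sup>2"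
    by (simp add: algebra_simps)
  \<comment> \<open>Linearity of expectation: the separated mass is a sum of edge indicators
    weighted by \<open>a\<close>.\<close>
  have "measure_pmf.expectation (greedy E V) (\<lambda>P. separated_mass E P a)
      = measure_pmf.expectation (greedy E V) (\<lambda>P. \<Sum>e\<in>E. a e * of_bool (separated P e))"
    using finE by (simp add: separated_mass_def of_bool_def sum.If_cases if_distrib Int_def cong: if_cong)
  also have "\<dots> = (\<Sum>e\<in>E. a e * sep_prob E V e)"
    using finite_set_pmf_greedy[OF fin, of E]
    by (simp add: sep_prob_def Bochner_Integration.integral_sum integrable_measure_pmf_finite)
  finally have mass: "measure_pmf.expectation (greedy E V) (\<lambda>P. separated_mass E P a)
      = (\<Sum>e\<in>E. a e * sep_prob E V e)" .
  have "2 * (\<Sum>e\<in>E. sqrt (a e))\<^sup>2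
      \<le> (\<Sum>e\<in>E. a e * sep_prob E V e) * (2 * (\<Sum>e\<in>E. 1 / sep_prob E V e))"
    using sum_sqrt_squared_le[of E "sep_prob E V" a] pos a by simp
  also have "\<dots> \<le> (\<Sum>e\<in>E. a e * sep_prob E V e) * ((1 - 1 / real \<omega>) * (real n)\<^sup>2)"
    using a pos bound by (intro mult_left_mono sum_nonneg) (auto simp: less_imp_le)
  finally show "2 / ((1 - 1 / real \<omega>) * (real n)\<^sup>2) * (\<Sum>e\<in>E. sqrt (a e))\<^sup>2
      \<le> measure_pmf.expectation (greedy E V) (\<lambda>P. separated_mass E P a)"
    using \<open>\<omega> \<ge> 2\<close> \<open>n > 0\<close> unfolding mass by (simp add: field_simps)
qed

end
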